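(* Let $\mathcal{E}^2$ be a classical overlapping generations economy with fiat money satisfying the standing assumptions listed in the context, $\mathcal{H}^2$ its set of monetary equilibria (price of money normalized to $1$), $\mathcal{H}^{2PO}\subseteq\mathcal{H}^2$ the subset of Pareto optimal ones, $\mathcal{E}^G$ the associated economy with Government and $\mathcal{H}^G$ its set of equilibria. Let $\rho:\mathcal{H}^G\to\mathbb{R}^\infty_{++}$, $\rho(r,q)=p$, with $p_1=q_1$ and $p_t=q_t/\prod_{i=1}^{t-1}(1+r_i)$, $t\ge2$. Fix $\theta_1,\theta_2>0$, a past price level $\Vert q_0\Vert>0$, an inflation ceiling $\pi^*>-1$ and a relative aggregate real savings floor $\tau^*>0$. For $(r,q)\in\mathcal{H}^G$ let $\pi_t=\Vert q_{t+1}\Vert/\Vert q_t\Vert-1$, $t\ge0$, and let $\mathcal{T}_3(r,q)\in\mathbb{R}^\infty_+$ be the Taylor rule whose $t$-th component, $t\ge1$, is $$r_t+\theta_1\mathbf{1}_{(\pi^*,\infty)}(\pi_{t-1})+\theta_2\mathbf{1}_{(-\infty,\tau^*]}\!\left(\frac{\sum_{h\in G_t}s^h(q_t,(1+r_t)^{-1}q_{t+1})}{\sum_{h\in G_t}\Vert e^h_t\Vert}\right),$$ where $\mathbf{1}_A$ is the indicator function of $A$. If $(r,q)\in\mathcal{H}^G$ is stable relative to $\mathcal{T}_3$, i.e. $r=\mathcal{T}_3(r,q)$, then $\pi_t\le\pi^*$ for all $t\ge0$, $$\frac{\sum_{h\in G_t}s^h(q_t,(1+r_t)^{-1}q_{t+1})}{\sum_{h\in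 G_t}\Vert e^h_t\Vert}>\tau^*\quad\text{for all } t\ge1,$$ and $\rho(r,q)\in\mathcal{H}^{2PO}$.
   Context: Notation: $\Vert c\Vert=\sum_i|c_i|$; $\mathbb{R}_+^n$, $\mathbb{R}_{++}^n$ are the vectors with non-negative, resp. strictly positive, coordinates; $p_t=(p_{t1},\ldots,p_{tL_t})\in\mathbb{R}^{L_t}$. Vectors indexed by the commodities of some periods are regarded as vectors over all commodities, with $0$ in the remaining coordinates. $\Vert q_0\Vert>0$ is a given constant (the price level of the period preceding $t=1$). Economy $\mathcal{E}^2$: commodity periods are $t=1,2,\ldots$, with $L_t\ge1$ perishable commodities in period $t$. $G_t$ ($t\ge0$) is the (finite, non-empty) generation born in period $t$. A household $h\in G_t$, $t\ge1$, lives in periods $t,t+1$ and has consumption set $\mathbb{R}^{L_t+L_{t+1}}_+$, a nonzero endowment $e^h=(e^h_t,e^h_{t+1})\in\mathbb{R}^{L_t+L_{t+1}}_+$ and a utility $u^h:\mathbb{R}^{L_t+L_{t+1}}_+\to\mathbb{R}$. A household $h\in G_0$ has a utility $u^h:\mathbb{R}^{L_1}_+\to\mathbb{R}$, a nonzero endowment $e^h=e^h_1\in\mathbb{R}^{L_1}_+$ and an amount of fiat money $m^h\ge0$, with $\sum_{h\in G_0}m^h=1$. All utilities are continuous, non-decreasing, without local maxima and semi-strictly quasiconcave (i.e. $u(\tilde c)\ge u(c)$ implies $u(\alpha\tilde c+(1-\alpha)c)\ge u(c)$ for $0\le\alpha\le1$, and $u(\tilde c)>u(c)$ implies $u(\alpha\tilde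 c+(1-\alpha)c)>u(c)$ for $0<\alpha\le1$). $\sum_{t\ge0}\sum_{h\in G_t}e^h\in\mathbb{R}^\infty_{++}$. Demand in $\mathcal{E}^2$ (assumed single-valued): for $h\in G_t$, $t\ge1$, $x^h(p_t,p_{t+1})=(x^h_t,x^h_{t+1})(p_t,p_{t+1})$ maximizes $u^h(c)$ over $c\in\mathbb{R}^{L_t+L_{t+1}}_+$ with $(p_t,p_{t+1})\cdot(c-e^h)\le0$. For $h\in G_0$, $x^h_1(p_m,p_1)$ maximizes $u^h(c)$ over $c\in\mathbb{R}^{L_1}_+$ with $p_1\cdot(c-e^h_1)\le p_mm^h$, $(p_m,p_1)\in\mathbb{R}_+\times\mathbb{R}^{L_1}_{++}$. Real savings of $h\in G_t$, $t\ge1$: $s^h(p_t,p_{t+1})=\frac{p_t}{\Vert p_t\Vert}\cdot(e^h_t-x^h_t(p_t,p_{t+1}))$. An equilibrium of $\mathcal{E}^2$ is $(p_m,p)$, $p_m\ge0$, $p=(p_1,p_2,\ldots)\in\mathbb{R}^\infty_{++}$, with $\sum_{h\in G_0}x^h_1(p_m,p_1)+\sum_{h\in G_1}x^h_1(p_1,p_2)=\sum_{h\in G_0\cup G_1}e^h_1$ and $\sum_{h\in G_{t-1}}x^h_t(p_{t-1},p_t)+\sum_{h\in G_t}x^h_t(p_t,p_{t+1})=\sum_{h\in G_{t-1}\cup G_t}e^h_t$ for $t\ge2$. $\mathcal{H}^2$ is the set of $p\in\mathbb{R}^\infty_{++}$ such that $(1,p)$ is an equilibrium. An equilibrium is Pareto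 optimal if no family of non-negative consumption bundles with the same aggregate as the equilibrium allocation gives every household at least its equilibrium utility and some household strictly more; $\mathcal{H}^{2PO}$ is the set of $p\in\mathcal{H}^2$ such that $(1,p)$ is Pareto optimal. Standing assumptions on $\mathcal{E}^2$: (a) there are $0<\alpha_{\min}<\alpha_{\max}$ with $\sum_{h\in G_{t+1}}\Vert e^h_{t+1}\Vert/\sum_{h\in G_t}\Vert e^h_{t+1}\Vert\in(\alpha_{\min},\alpha_{\max})$ for all $t\ge0$; put $\beta=\max\{1+\alpha_{\min}^{-1},1+\alpha_{\max}\}$. (b) For every $j\ge0$ all households in $\bigcup_{t=0}^jG_t$ are indirectly resource related to one another, where $h'$ is resource related to $h''$ if for every family of non-negative consumption bundles $\{c^h\}_{h\in\bigcup_{t=0}^jG_t}$ with $\sum_hc^h\le\sum_he^h$ there are another such family $\{\tilde c^h\}$ and $y\ge0$ over the commodities of periods $1,\ldots,j+1$ with $\sum_h\tilde c^h\le\sum_he^h+y$, $u^h(\tilde c^h)\ge u^h(c^h)$ for all $h$, $u^{h''}(\tilde c^{h''})>u^{h''}(c^{h''})$, and $y_{ti}>0$ only if $e^{h'}_{ti}>0$; "indirectly" means via a finite chain of households each resource related to the next. (c) An equilibrium $(p_m,p)$ of $\mathcal{E}^2$ is Pareto optimal iff $\sum_{t=1}^\infty(\Vert p_t\Vert\sum_{h\in G_t}\Vert e^h_t\Vert)^{-1}=+\infty$. (d) With $\mathcal{B}_t(\sigma)=\{p\in\mathbb{R}^{L_t+L_{t+1}}_{++}\mid\sigma\le p_i\le\sigma^{-1}\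 \forall i\}$, for all $t\ge1$ there is $\sigma_t\in(0,1)$ such that $(p_t/p_{t1},p_{t+1}/p_{t1})\notin\mathcal{B}_t(\sigma_t)$ implies $\sum_{h\in G_t}\Vert x^h(p_t,p_{t+1})\Vert>\beta\sum_{h\in G_t}\Vert e^h\Vert$; moreover $\inf_{t\ge1}\sigma_t>0$ and $\sup_{t\ge1}L_t<\infty$. (e) There are $\varepsilon,\delta>0$ such that for all $t\ge1$ and $(p_t/p_{t1},p_{t+1}/p_{t1})\in\mathcal{B}_t(\sigma_t)$, $\sum_{h\in G_t}s^h(p_t,p_{t+1})\le\delta\sum_{h\in G_t}\Vert e^h_t\Vert$ implies $\frac{\Vert p_t\Vert}{\Vert p_{t+1}\Vert}\le\frac1{1+\varepsilon}\frac{\sum_{h\in G_{t+1}}\Vert e^h_{t+1}\Vert}{\sum_{h\in G_t}\Vert e^h_t\Vert}$. (f) There is $\lambda>0$ such that for $p_1\in\mathbb{R}^{L_1}_{++}$, $\min_ip_{1i}<\lambda$ implies $\sum_{h\in G_0}\Vert x^h_1(1,p_1)\Vert>\beta\sum_{h\in G_0}\Vert e^h_1\Vert$. Economy $\mathcal{E}^G$: same preferences and endowments as $\mathcal{E}^2$. A monetary policy is a sequence of nominal interest rates $r=(r_1,r_2,\ldots)\in\mathbb{R}^\infty_+$; $q=(q_1,q_2,\ldots)\in\mathbb{R}^\infty_{++}$, $q_t\in\mathbb{R}^{L_t}_{++}$, is a sequence of spot prices in current money. Household $h\in G_t$, $t\ge1$, demands $\tilde x^h(r_t,q_t,q_{t+1})=(\tilde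 x^h_t,\tilde x^h_{t+1})$, the maximizer of $u^h(c)$ over $c\in\mathbb{R}^{L_t+L_{t+1}}_+$ with $(q_t,(1+r_t)^{-1}q_{t+1})\cdot(c-e^h)=0$. Household $h\in G_0$ holds $b^h=m^h$ government bonds and demands $\tilde x^h_1(q_1)$, the maximizer of $u^h(c)$ over $c\in\mathbb{R}^{L_1}_+$ with $q_1\cdot c=b^h+q_1\cdot e^h_1$. $(r,q)\in\mathbb{R}^\infty_+\times\mathbb{R}^\infty_{++}$ is an equilibrium of $\mathcal{E}^G$ if $\sum_{h\in G_0}\tilde x^h_1(q_1)+\sum_{h\in G_1}\tilde x^h_1(r_1,q_1,q_2)=\sum_{h\in G_0}e^h_1+\sum_{h\in G_1}e^h_1$ and $\sum_{h\in G_{t-1}}\tilde x^h_t(r_{t-1},q_{t-1},q_t)+\sum_{h\in G_t}\tilde x^h_t(r_t,q_t,q_{t+1})=\sum_{h\in G_{t-1}}e^h_t+\sum_{h\in G_t}e^h_t$ for $t\ge2$; $\mathcal{H}^G$ is the set of these. *)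

theory Defs
  imports "HOL-Analysis.Analysis"
begin

text \<open>
  The commodities of period \<open>t \<ge> 1\<close> are the pairs \<open>(t, i)\<close> with \<open>1 \<le> i \<le> L\<^sub>t\<close>.
  An \<open>n\<close>-dimensional vector is a function on \<open>nat\<close> that vanishes outside \<open>{1..n}\<close>. A consumption
  bundle or a sequence of price vectors maps a period and an index to a real number, with value
  \<open>0\<close> at the pairs over which it does not range. A sequence of real numbers indexed by \<open>t \<ge> 1\<close> is
  a function on \<open>nat\<close> with value \<open>0\<close> at \<open>0\<close>.
\<close>

type_synonym rvec = "nat \<Rightarrow> real"
type_synonym cbundle = "nat \<Rightarrow> nat \<Rightarrow> real"

definition vnorm :: "nat \<Rightarrow> rvec \<Rightarrow> real" where
  "vnorm n v = (\<Sum>i=1..n. \<bar>v i\<bar>)"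

definition dot :: "nat \<Rightarrow> rvec \<Rightarrow> rvec \<Rightarrow> real" where
  "dot n v w = (\<Sum>i=1..n. v i * w i)"

definition pos_vec :: "nat \<Rightarrow> rvec set" where
  "pos_vec n = {v. (\<forall>i\<in>{1..n}. 0 < v i) \<and> (\<forall>i. i \<notin> {1..n} \<longrightarrow> v i = 0)}"


subsection \<open>The economy\<close>

text \<open>The type \<open>'h\<close> is the set of all households. The money component matters only for
  households of generation 0.\<close>

record 'h economy =
  ncomm :: "nat \<Rightarrow> nat"
  birth :: "'h \<Rightarrow> nat"
  endow :: "'h \<Rightarrow> cbundle"
  util :: "'h \<Rightarrow> cbundle \<Rightarrow> real"
  money :: "'h \<Rightarrow> real"

definition gen :: "'h economy \<Rightarrow> nat \<Rightarrow> 'h set" where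
  "gen E t = {h. birth E h = t}"

definition life :: "'h economy \<Rightarrow> 'h \<Rightarrow> nat set" where
  "life E h = (if birth E h = 0 then {1} else {birth E h, birth E h + 1})"

definition cons_set :: "'h economy \<Rightarrow> 'h \<Rightarrow> cbundle set" where
  "cons_set E h = {c. \<forall>t i. if t \<in> life E h \<and> i \<in> {1..ncomm E t} then 0 \<le> c t i else c t i = 0}"

definition bnorm :: "'h economy \<Rightarrow> 'h \<Rightarrow> cbundle \<Rightarrow> real" where
  "bnorm E h c = (\<Sum>t\<in>life E h. vnorm (ncomm E t) (c t))"

text \<open>\<open>gen_endow E t s\<close> is the sum of \<open>\<parallel>e\<^sup>h\<^sub>s\<parallel>\<close> over generation \<open>t\<close>.\<close>

definition gen_endow :: "'h economy \<Rightarrow> nat \<Rightarrow> nat \<Rightarrow> real" where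
  "gen_endow E t s = (\<Sum>h\<in>gen E t. vnorm (ncomm E s) (endow E h s))"

definition pos_prices :: "'h economy \<Rightarrow> cbundle set" where
  "pos_prices E = {p. p 0 = (\<lambda>_. 0) \<and> (\<forall>t\<ge>1. p t \<in> pos_vec (ncomm E t))}"

definition nonneg_rates :: "(nat \<Rightarrow> real) set" where
  "nonneg_rates = {r. r 0 = 0 \<and> (\<forall>t\<ge>1. 0 \<le> r t)}"

definition budget :: "'h economy \<Rightarrow> 'h \<Rightarrow> rvec \<Rightarrow> rvec \<Rightarrow> cbundle set" where
  "budget E h p p' = (let t = birth E h in
     {c \<in> cons_set E h.
        dot (ncomm E t) p (\<lambda>i. c t i - endow E h t i)
      + dot (ncomm E (t + 1)) p' (\<lambda>i. c (t + 1) i - endow E h (t + 1) i) \<le> 0})"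

definition budget0 :: "'h economy \<Rightarrow> 'h \<Rightarrow> real \<Rightarrow> rvec \<Rightarrow> cbundle set" where
  "budget0 E h pm p1 =
     {c \<in> cons_set E h. dot (ncomm E 1) p1 (\<lambda>i. c 1 i - endow E h 1 i) \<le> pm * money E h}"

text \<open>Consumption sets carry the subspace topology of the product topology, which on them is the
  Euclidean one, since all but finitely many coordinates vanish.\<close>

definition no_local_max_on :: "cbundle set \<Rightarrow> (cbundle \<Rightarrow> real) \<Rightarrow> bool" where
  "no_local_max_on X u \<longleftrightarrow> \<not> (\<exists>c\<in>X. \<forall>\<^sub>F c' in at c within X. u c' \<le> u c)"

definition semistrictly_quasiconcave_on :: "cbundle set \<Rightarrow> (cbundle \<Rightarrow> real) \<Rightarrow> bool" where
  "semistrictly_quasiconcave_on X u \<longleftrightarrow> (\<forall>c\<in>X. \<forall>c'\<in>X.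
     (u c' \<ge> u c \<longrightarrow> (\<forall>\<alpha>. 0 \<le> \<alpha> \<and> \<alpha> \<le> 1 \<longrightarrow>
        u (\<lambda>t i. \<alpha> * c' t i + (1 - \<alpha>) * c t i) \<ge> u c)) \<and>
     (u c' > u c \<longrightarrow> (\<forall>\<alpha>. 0 < \<alpha> \<and> \<alpha> \<le> 1 \<longrightarrow>
        u (\<lambda>t i. \<alpha> * c' t i + (1 - \<alpha>) * c t i) > u c)))"

locale olg_economy =
  fixes E :: "'h economy"
  assumes ncomm_pos: "\<And>t. 1 \<le> t \<Longrightarrow> 1 \<le> ncomm E t"
    and gen_finite: "\<And>t. finite (gen E t)"
    and gen_nonempty: "\<And>t. gen E t \<noteq> {}"
    and endow_cons: "\<And>h. endow E h \<in> cons_set E h"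
    and endow_nonzero: "\<And>h. endow E h \<noteq> (\<lambda>t i. 0)"
    and money_nonneg: "\<And>h. h \<in> gen E 0 \<Longrightarrow> 0 \<le> money E h"
    and money_sum: "(\<Sum>h\<in>gen E 0. money E h) = 1"
    and util_cont: "\<And>h. continuous_on (cons_set E h) (util E h)"
    and util_mono: "\<And>h. mono_on (cons_set E h) (util E h)"
    and util_no_local_max: "\<And>h. no_local_max_on (cons_set E h) (util E h)"
    and util_quasiconcave: "\<And>h. semistrictly_quasiconcave_on (cons_set E h) (util E h)"
    \<comment> \<open>only generations \<open>t - 1\<close> and \<open>t\<close> can own commodities of period \<open>t\<close>\<close>
    and agg_endow_pos: "\<And>t i. 1 \<le> t \<Longrightarrow> i \<in> {1..ncomm E t} \<Longrightarrow>
          0 < (\<Sum>h\<in>gen E (t - 1) \<union> gen E t. endow E h t i)"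
    and demand_single_valued: "\<And>h p p'. 1 \<le> birth E h \<Longrightarrow>
          p \<in> pos_vec (ncomm E (birth E h)) \<Longrightarrow> p' \<in> pos_vec (ncomm E (birth E h + 1)) \<Longrightarrow>
          \<exists>!c. is_arg_max (util E h) (\<lambda>c. c \<in> budget E h p p') c"
    and demand0_single_valued: "\<And>h pm p1. birth E h = 0 \<Longrightarrow> 0 \<le> pm \<Longrightarrow>
          p1 \<in> pos_vec (ncomm E 1) \<Longrightarrow>
          \<exists>!c. is_arg_max (util E h) (\<lambda>c. c \<in> budget0 E h pm p1) c"


subsection \<open>Demand and equilibria of the economy with fiat money\<close>

definition demand :: "'h economy \<Rightarrow> 'h \<Rightarrow> rvec \<Rightarrow> rvec \<Rightarrow> cbundle" where
  "demand E h p p' = arg_max_on (util E h) (budget E h p p')"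

definition demand0 :: "'h economy \<Rightarrow> 'h \<Rightarrow> real \<Rightarrow> rvec \<Rightarrow> cbundle" where
  "demand0 E h pm p1 = arg_max_on (util E h) (budget0 E h pm p1)"

definition savings :: "'h economy \<Rightarrow> 'h \<Rightarrow> rvec \<Rightarrow> rvec \<Rightarrow> real" where
  "savings E h p p' = (let t = birth E h in
     dot (ncomm E t) (\<lambda>i. p i / vnorm (ncomm E t) p)
       (\<lambda>i. endow E h t i - demand E h p p' t i))"

definition alloc :: "'h economy \<Rightarrow> real \<Rightarrow> cbundle \<Rightarrow> 'h \<Rightarrow> cbundle" where
  "alloc E pm p h = (let t = birth E h in
     if t = 0 then demand0 E h pm (p 1) else demand E h (p t) (p (t + 1)))"

definition markets_clear :: "'h economy \<Rightarrow> ('h \<Rightarrow> cbundle) \<Rightarrow> bool" where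
  "markets_clear E x \<longleftrightarrow> (\<forall>t\<ge>1. \<forall>i\<in>{1..ncomm E t}.
     (\<Sum>h\<in>gen E (t - 1). x h t i) + (\<Sum>h\<in>gen E t. x h t i)
       = (\<Sum>h\<in>gen E (t - 1) \<union> gen E t. endow E h t i))"

definition equilibrium :: "'h economy \<Rightarrow> real \<Rightarrow> cbundle \<Rightarrow> bool" where
  "equilibrium E pm p \<longleftrightarrow> 0 \<le> pm \<and> p \<in> pos_prices E \<and> markets_clear E (alloc E pm p)"

definition pareto_optimal :: "'h economy \<Rightarrow> real \<Rightarrow> cbundle \<Rightarrow> bool" where
  "pareto_optimal E pm p \<longleftrightarrow> \<not> (\<exists>c.
     (\<forall>h. c h \<in> cons_set E h) \<and>
     (\<forall>t\<ge>1. \<forall>i\<in>{1..ncomm E t}.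
        (\<Sum>h\<in>gen E (t - 1) \<union> gen E t. c h t i)
          = (\<Sum>h\<in>gen E (t - 1) \<union> gen E t. alloc E pm p h t i)) \<and>
     (\<forall>h. util E h (c h) \<ge> util E h (alloc E pm p h)) \<and>
     (\<exists>h. util E h (c h) > util E h (alloc E pm p h)))"

definition H2 :: "'h economy \<Rightarrow> cbundle set" where
  "H2 E = {p. equilibrium E 1 p}"

definition H2PO :: "'h economy \<Rightarrow> cbundle set" where
  "H2PO E = {p \<in> H2 E. pareto_optimal E 1 p}"


subsection \<open>Standing assumptions\<close>

definition endow_ratio_bounded :: "'h economy \<Rightarrow> real \<Rightarrow> real \<Rightarrow> bool" where
  "endow_ratio_bounded E \<alpha>min \<alpha>max \<longleftrightarrow> 0 < \<alpha>min \<and> \<alpha>min < \<alpha>max \<and>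
     (\<forall>t. gen_endow E (t + 1) (t + 1) / gen_endow E t (t + 1) \<in> {\<alpha>min<..<\<alpha>max})"

definition beta :: "real \<Rightarrow> real \<Rightarrow> real" where
  "beta \<alpha>min \<alpha>max = max (1 + inverse \<alpha>min) (1 + \<alpha>max)"

definition households_upto :: "'h economy \<Rightarrow> nat \<Rightarrow> 'h set" where
  "households_upto E j = (\<Union>t\<le>j. gen E t)"

definition resource_related :: "'h economy \<Rightarrow> nat \<Rightarrow> 'h \<Rightarrow> 'h \<Rightarrow> bool" where
  "resource_related E j h' h'' \<longleftrightarrow> (let H = households_upto E j in
     h' \<in> H \<and> h'' \<in> H \<and>
     (\<forall>c. (\<forall>h\<in>H. c h \<in> cons_set E h) \<and>
          (\<forall>t i. (\<Sum>h\<in>H. c h t i) \<le> (\<Sum>h\<in>H. endow E h t i)) \<longrightarrow>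
       (\<exists>c' y. (\<forall>h\<in>H. c' h \<in> cons_set E h) \<and>
          (\<forall>t i. 0 \<le> y t i) \<and>
          (\<forall>t i. (\<Sum>h\<in>H. c' h t i) \<le> (\<Sum>h\<in>H. endow E h t i) + y t i) \<and>
          (\<forall>h\<in>H. util E h (c' h) \<ge> util E h (c h)) \<and>
          util E h'' (c' h'') > util E h'' (c h'') \<and>
          (\<forall>t i. 0 < y t i \<longrightarrow> 0 < endow E h' t i))))"

text \<open>The reflexive closure makes no demand on a household paired with itself.\<close>

definition indirectly_resource_related :: "'h economy \<Rightarrow> bool" where
  "indirectly_resource_related E \<longleftrightarrow> (\<forall>j. \<forall>h'\<in>households_upto E j. \<forall>h''\<in>households_upto E j.
     (resource_related E j)\<^sup>*\<^sup>* h' h'')"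

definition pareto_criterion :: "'h economy \<Rightarrow> bool" where
  "pareto_criterion E \<longleftrightarrow> (\<forall>pm p. equilibrium E pm p \<longrightarrow>
     (pareto_optimal E pm p \<longleftrightarrow>
       (\<Sum>t. ennreal (inverse (vnorm (ncomm E (t + 1)) (p (t + 1)) * gen_endow E (t + 1) (t + 1)))) = \<infinity>))"

definition price_box :: "'h economy \<Rightarrow> nat \<Rightarrow> real \<Rightarrow> (rvec \<times> rvec) set" where
  "price_box E t s = {(p, p'). p \<in> pos_vec (ncomm E t) \<and> p' \<in> pos_vec (ncomm E (t + 1)) \<and>
     (\<forall>i\<in>{1..ncomm E t}. s \<le> p i \<and> p i \<le> inverse s) \<and>
     (\<forall>i\<in>{1..ncomm E (t + 1)}. s \<le> p' i \<and> p' i \<le> inverse s)}"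

definition excess_demand_outside_box :: "'h economy \<Rightarrow> real \<Rightarrow> (nat \<Rightarrow> real) \<Rightarrow> bool" where
  "excess_demand_outside_box E \<beta> \<sigma> \<longleftrightarrow>
     (\<forall>t\<ge>1. 0 < \<sigma> t \<and> \<sigma> t < 1 \<and>
       (\<forall>p\<in>pos_vec (ncomm E t). \<forall>p'\<in>pos_vec (ncomm E (t + 1)).
          ((\<lambda>i. p i / p 1), (\<lambda>i. p' i / p 1)) \<notin> price_box E t (\<sigma> t) \<longrightarrow>
          (\<Sum>h\<in>gen E t. bnorm E h (demand E h p p'))
            > \<beta> * (\<Sum>h\<in>gen E t. bnorm E h (endow E h)))) \<and>
     0 < (INF t\<in>{1..}. \<sigma> t) \<and>
     bdd_above (ncomm E ` {1..})"

definition low_savings_low_return :: "'h economy \<Rightarrow> (nat \<Rightarrow> real) \<Rightarrow> bool" where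
  "low_savings_low_return E \<sigma> \<longleftrightarrow> (\<exists>\<epsilon>>0. \<exists>\<delta>>0. \<forall>t\<ge>1.
     \<forall>p\<in>pos_vec (ncomm E t). \<forall>p'\<in>pos_vec (ncomm E (t + 1)).
       ((\<lambda>i. p i / p 1), (\<lambda>i. p' i / p 1)) \<in> price_box E t (\<sigma> t) \<longrightarrow>
       (\<Sum>h\<in>gen E t. savings E h p p') \<le> \<delta> * gen_endow E t t \<longrightarrow>
       vnorm (ncomm E t) p / vnorm (ncomm E (t + 1)) p'
         \<le> 1 / (1 + \<epsilon>) * (gen_endow E (t + 1) (t + 1) / gen_endow E t t))"

definition excess_demand_initial :: "'h economy \<Rightarrow> real \<Rightarrow> bool" where
  "excess_demand_initial E \<beta> \<longleftrightarrow> (\<exists>lam>0. \<forall>p1\<in>pos_vec (ncomm E 1).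
     Min (p1 ` {1..ncomm E 1}) < lam \<longrightarrow>
     (\<Sum>h\<in>gen E 0. bnorm E h (demand0 E h 1 p1)) > \<beta> * (\<Sum>h\<in>gen E 0. bnorm E h (endow E h)))"

definition standing_assumptions :: "'h economy \<Rightarrow> bool" where
  "standing_assumptions E \<longleftrightarrow> olg_economy E \<and>
     (\<exists>\<alpha>min \<alpha>max \<sigma>.
        endow_ratio_bounded E \<alpha>min \<alpha>max \<and>
        indirectly_resource_related E \<and>
        pareto_criterion E \<and>
        excess_demand_outside_box E (beta \<alpha>min \<alpha>max) \<sigma> \<and>
        low_savings_low_return E \<sigma> \<and>
        excess_demand_initial E (beta \<alpha>min \<alpha>max))"


subsection \<open>The economy with Government\<close>

definition gov_budget :: "'h economy \<Rightarrow> 'h \<Rightarrow> real \<Rightarrow> rvec \<Rightarrow> rvec \<Rightarrow> cbundle set" where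
  "gov_budget E h rt q q' = (let t = birth E h in
     {c \<in> cons_set E h.
        dot (ncomm E t) q (\<lambda>i. c t i - endow E h t i)
      + dot (ncomm E (t + 1)) (\<lambda>i. inverse (1 + rt) * q' i)
          (\<lambda>i. c (t + 1) i - endow E h (t + 1) i) = 0})"

text \<open>Initial bond holdings coincide with the holdings of fiat money.\<close>

definition gov_budget0 :: "'h economy \<Rightarrow> 'h \<Rightarrow> rvec \<Rightarrow> cbundle set" where
  "gov_budget0 E h q1 =
     {c \<in> cons_set E h. dot (ncomm E 1) q1 (c 1) = money E h + dot (ncomm E 1) q1 (endow E h 1)}"

definition gov_demand :: "'h economy \<Rightarrow> 'h \<Rightarrow> real \<Rightarrow> rvec \<Rightarrow> rvec \<Rightarrow> cbundle" where
  "gov_demand E h rt q q' = arg_max_on (util E h) (gov_budget E h rt q q')"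

definition gov_demand0 :: "'h economy \<Rightarrow> 'h \<Rightarrow> rvec \<Rightarrow> cbundle" where
  "gov_demand0 E h q1 = arg_max_on (util E h) (gov_budget0 E h q1)"

definition gov_alloc :: "'h economy \<Rightarrow> (nat \<Rightarrow> real) \<Rightarrow> cbundle \<Rightarrow> 'h \<Rightarrow> cbundle" where
  "gov_alloc E r q h = (let t = birth E h in
     if t = 0 then gov_demand0 E h (q 1) else gov_demand E h (r t) (q t) (q (t + 1)))"

definition HG :: "'h economy \<Rightarrow> ((nat \<Rightarrow> real) \<times> cbundle) set" where
  "HG E = {(r, q). r \<in> nonneg_rates \<and> q \<in> pos_prices E \<and> markets_clear E (gov_alloc E r q)}"

definition rho :: "(nat \<Rightarrow> real) \<Rightarrow> cbundle \<Rightarrow> cbundle" where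
  "rho r q = (\<lambda>t i. q t i / (\<Prod>k\<in>{1..<t}. 1 + r k))"

text \<open>The price level of the period preceding period 1 is the constant \<open>q0\<close>.\<close>

definition inflation :: "'h economy \<Rightarrow> real \<Rightarrow> cbundle \<Rightarrow> nat \<Rightarrow> real" where
  "inflation E q0 q t =
     vnorm (ncomm E (t + 1)) (q (t + 1)) / (if t = 0 then q0 else vnorm (ncomm E t) (q t)) - 1"

definition rel_savings :: "'h economy \<Rightarrow> (nat \<Rightarrow> real) \<Rightarrow> cbundle \<Rightarrow> nat \<Rightarrow> real" where
  "rel_savings E r q t =
     (\<Sum>h\<in>gen E t. savings E h (q t) (\<lambda>i. inverse (1 + r t) * q (t + 1) i)) / gen_endow E t t"

definition taylor3 ::
  "'h economy \<Rightarrow> real \<Rightarrow> real \<Rightarrow> real \<Rightarrow> real \<Rightarrow> real \<Rightarrow> (nat \<Rightarrow> real) \<Rightarrow> cbundle \<Rightarrow> nat \<Rightarrow> real" where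
  "taylor3 E \<theta>1 \<theta>2 q0 pistar taustar r q = (\<lambda>t. if t = 0 then 0 else
     r t + \<theta>1 * indicator {pistar<..} (inflation E q0 q (t - 1))
         + \<theta>2 * indicator {..taustar} (rel_savings E r q t))"

end

theory Submission
  imports Defs
begin

text \<open>
  A fixed point of the Taylor rule leaves both indicators at 0, so inflation stays below the ceiling
  and relative savings stay above \<open>\<tau>\<^sup>*\<close>. Local nonsatiation turns budget inequalities into
  equalities, so \<open>\<rho>(r, q) = p\<close> has the same allocation as \<open>(r, q)\<close>. By Walras' law the nominal
  savings \<open>\<Sum> p\<^sub>t \<cdot> (e\<^sub>t - x\<^sub>t)\<close> of every generation equal the money stock 1. Hence the relative
  real savings of generation \<open>t\<close> are the \<open>t\<close>-th term of the series in the Pareto criterion,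
  and a series whose terms all exceed \<open>\<tau>\<^sup>* > 0\<close> diverges.
\<close>

section \<open>Maximizers and binding constraints\<close>

lemma arg_max_on_subset_eq:
  fixes u :: "'a \<Rightarrow> 'b::linorder"
  assumes ex1: "\<exists>!c. is_arg_max u (\<lambda>c. c \<in> B) c"
    and sub: "B' \<subseteq> B"
    and mem: "\<And>c. is_arg_max u (\<lambda>c. c \<in> B) c \<Longrightarrow> c \<in> B'"
  shows "arg_max_on u B' = arg_max_on u B"
proof -
  obtain c where c: "is_arg_max u (\<lambda>c. c \<in> B) c"
    using ex1 by blast
  \<comment> \<open>The maximizer \<open>c\<close> over \<open>B\<close> lies in \<open>B'\<close>,
    so a maximizer over \<open>B'\<close> is worth at least as much and is optimal in all of
    \<open>B\<close>. Equal predicates make the choice operator behind \<open>arg_max_on\<close>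
    pick the same element.\<close>
  have "is_arg_max u (\<lambda>c. c \<in> B') d \<longleftrightarrow> is_arg_max u (\<lambda>c. c \<in> B) d" for d
    using c mem[OF c] mem[of d] sub unfolding is_arg_max_linorder
    by (meson order_trans subsetD)
  then show ?thesis
    unfolding arg_max_on_def arg_max_def by presburger
qed

lemma is_arg_max_arg_max_on:
  assumes "\<exists>c. is_arg_max u (\<lambda>c. c \<in> B) c"
  shows "is_arg_max u (\<lambda>c. c \<in> B) (arg_max_on u B)"
  using someI_ex[OF assms] unfolding arg_max_on_def arg_max_def .

text \<open>If \<open>g c < b\<close>, continuity keeps the constraint satisfied near
  \<open>c\<close> in \<open>X\<close>, and optimality then makes \<open>c\<close> a local maximum
  of \<open>u\<close> on \<open>X\<close>.\<close>

lemma no_local_max_constraint_binds: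
  fixes g :: "cbundle \<Rightarrow> real"
  assumes nlm: "no_local_max_on X u"
    and cont: "continuous_on UNIV g"
    and max: "is_arg_max u (\<lambda>c. c \<in> {c \<in> X. g c \<le> b}) c"
  shows "g c = b"
proof (rule ccontr)
  assume "g c \<noteq> b"
  with max have cX: "c \<in> X" and lt: "g c < b"
    by (auto simp: is_arg_max_def)
  have "(g \<longlongrightarrow> g c) (at c within X)"
    using cont by (meson UNIV_I continuous_on continuous_on_subset subset_UNIV cX)
  then have "\<forall>\<^sub>F c' in at c within X. g c' < b"
    using lt by (rule order_tendstoD)
  moreover have "\<forall>\<^sub>F c' in at c within X. c' \<in> X"
    by (simp add: eventually_at_filter)
  ultimately have "\<forall>\<^sub>F c' in at c within X. u c' \<le> u c"
    by eventually_elim (use max in \<open>auto simp: is_arg_max_linorder\<close>)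
  with nlm cX show False
    unfolding no_local_max_on_def by blast
qed

lemma continuous_on_dot_coordinates:
  "continuous_on UNIV (\<lambda>c :: cbundle. dot n p (\<lambda>i. c t i - e i))"
proof -
  have "continuous_on UNIV (\<lambda>c :: cbundle. c t i)" for i
    by (rule continuous_on_compose2[OF continuous_on_product_coordinates
          continuous_on_product_coordinates]) auto
  then show ?thesis
    unfolding dot_def by (intro continuous_intros)
qed

section \<open>Price scaling and discounting to period 1\<close>

lemma dot_scale_left: "dot n (\<lambda>i. k * p i) w = k * dot n p w"
  by (simp add: dot_def sum_distrib_left mult.assoc)

lemma dot_minus: "dot n p (\<lambda>i. v i - w i) = dot n p v - dot n p w"
  by (simp add: dot_def right_diff_distrib sum_subtractf)

lemma dot_sum: "dot n p (\<lambda>i. \<Sum>h\<in>A. v h i) = (\<Sum>h\<in>A. dot n p (v h))"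
  unfolding dot_def sum_distrib_left by (rule sum.swap)

lemma vnorm_scale: "0 \<le> k \<Longrightarrow> vnorm n (\<lambda>i. k * p i) = k * vnorm n p"
  by (simp add: vnorm_def sum_distrib_left abs_mult)

lemma pos_vec_scale: "0 < k \<Longrightarrow> p \<in> pos_vec n \<Longrightarrow> (\<lambda>i. k * p i) \<in> pos_vec n"
  by (auto simp: pos_vec_def)

lemma budget_scale:
  assumes "0 < k"
  shows "budget E h (\<lambda>i. k * p i) (\<lambda>i. k * p' i) = budget E h p p'"
  using assms
  by (simp add: budget_def dot_scale_left distrib_left[symmetric] mult_le_0_iff Let_def)

lemma savings_scale:
  assumes "0 < k"
  shows "savings E h (\<lambda>i. k * p i) (\<lambda>i. k * p' i) = savings E h p p'"
  using assms
  by (simp add: savings_def demand_def budget_scale vnorm_scale Let_def)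

lemma savings_eq:
  "savings E h p p' =
     dot (ncomm E (birth E h)) p (\<lambda>i. endow E h (birth E h) i - demand E h p p' (birth E h) i)
       / vnorm (ncomm E (birth E h)) p"
  by (simp add: savings_def Let_def dot_def sum_divide_distrib)

text \<open>Passing from \<open>t\<close> to \<open>t + 1\<close> adds the factor
  \<open>1 + r t\<close> to the divisor in \<open>rho\<close>, which is exactly the discount applied
  by generation \<open>t\<close>. Its two price vectors thus share one factor \<open>k\<close>, so
  budgets and real savings can be computed at the prices \<open>rho r q\<close>.\<close>

lemma rho_scale:
  assumes "r \<in> nonneg_rates"
  obtains k where "0 < k" "q t = (\<lambda>i. k * rho r q t i)"
    and "1 \<le> t \<Longrightarrow> (\<lambda>i. inverse (1 + r t) * q (t + 1) i) = (\<lambda>i. k * rho r q (t + 1) i)"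
proof -
  have r: "0 < 1 + r t" if "1 \<le> t" for t
    using that assms by (force simp: nonneg_rates_def intro: add_pos_nonneg)
  define P where "P = (\<Prod>k\<in>{1..<t}. 1 + r k)"
  have P: "0 < P"
    unfolding P_def by (rule prod_pos) (use r in auto)
  have q_t: "q t = (\<lambda>i. P * rho r q t i)"
    unfolding rho_def P_def[symmetric] using P by simp
  have q_Suc: "(\<lambda>i. inverse (1 + r t) * q (t + 1) i) = (\<lambda>i. P * rho r q (t + 1) i)" if "1 \<le> t"
  proof -
    have P_Suc: "(\<Prod>k\<in>{1..<t + 1}. 1 + r k) = P * (1 + r t)"
      using that by (simp add: P_def)
    have "inverse (1 + r t) * x = P * (x / (P * (1 + r t)))" for x
      using P by (simp add: divide_inverse)
    then show ?thesis
      unfolding rho_def P_Suc by (rule ext)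
  qed
  show ?thesis
    by (rule that[OF P q_t q_Suc])
qed

lemma rho_pos_prices:
  assumes "r \<in> nonneg_rates" "q \<in> pos_prices E"
  shows "rho r q \<in> pos_prices E"
proof -
  have "rho r q t \<in> pos_vec (ncomm E t)" if "1 \<le> t" for t
  proof -
    obtain k where k: "0 < k" "q t = (\<lambda>i. k * rho r q t i)"
      using rho_scale[OF assms(1), of q t] by blast
    then have "rho r q t = (\<lambda>i. inverse k * q t i)"
      by (simp add: fun_eq_iff)
    then show ?thesis
      using pos_vec_scale[of "inverse k" "q t"] assms(2) that k(1) by (simp add: pos_prices_def)
  qed
  then show ?thesis
    using assms(2) by (simp add: pos_prices_def rho_def)
qed

lemma rho_1: "rho r q 1 = q 1"
  by (simp add: rho_def)

section \<open>Agreement of the two economies\<close>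

context olg_economy
begin

text \<open>\<open>arg_max_on\<close> is only a choice operator; the assumption that demand is
  single-valued makes the chosen bundle a genuine maximizer.\<close>

lemma demand_is_arg_max:
  assumes "1 \<le> birth E h" "p \<in> pos_vec (ncomm E (birth E h))"
    "p' \<in> pos_vec (ncomm E (birth E h + 1))"
  shows "is_arg_max (util E h) (\<lambda>c. c \<in> budget E h p p') (demand E h p p')"
  unfolding demand_def
  by (rule is_arg_max_arg_max_on) (use demand_single_valued[OF assms] in blast)

lemma demand0_is_arg_max:
  assumes "birth E h = 0" "0 \<le> pm" "p1 \<in> pos_vec (ncomm E 1)"
  shows "is_arg_max (util E h) (\<lambda>c. c \<in> budget0 E h pm p1) (demand0 E h pm p1)"
  unfolding demand0_def
  by (rule is_arg_max_arg_max_on) (use demand0_single_valued[OF assms] in blast)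

lemma arg_max_budget_binds:
  assumes "is_arg_max (util E h) (\<lambda>c. c \<in> budget E h p p') c"
  shows "dot (ncomm E (birth E h)) p (\<lambda>i. c (birth E h) i - endow E h (birth E h) i)
    + dot (ncomm E (birth E h + 1)) p' (\<lambda>i. c (birth E h + 1) i - endow E h (birth E h + 1) i) = 0"
  using no_local_max_constraint_binds[OF util_no_local_max
      continuous_on_add[OF continuous_on_dot_coordinates continuous_on_dot_coordinates]
      assms[unfolded budget_def Let_def]] .

lemma arg_max_budget0_binds:
  assumes "is_arg_max (util E h) (\<lambda>c. c \<in> budget0 E h pm p1) c"
  shows "dot (ncomm E 1) p1 (\<lambda>i. c 1 i - endow E h 1 i) = pm * money E h"
  using no_local_max_constraint_binds[OF util_no_local_max continuous_on_dot_coordinates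
      assms[unfolded budget0_def]] .

text \<open>The budget with Government is the part of \<open>budget\<close> at discounted prices
  where the constraint holds with equality, and every maximizer lies in that part.\<close>

lemma gov_demand_eq_demand:
  assumes "1 \<le> birth E h" "q \<in> pos_vec (ncomm E (birth E h))"
    "(\<lambda>i. inverse (1 + rt) * q' i) \<in> pos_vec (ncomm E (birth E h + 1))"
  shows "gov_demand E h rt q q' = demand E h q (\<lambda>i. inverse (1 + rt) * q' i)"
  unfolding gov_demand_def demand_def
proof (rule arg_max_on_subset_eq[OF demand_single_valued[OF assms]])
  show "gov_budget E h rt q q' \<subseteq> budget E h q (\<lambda>i. inverse (1 + rt) * q' i)"
    by (auto simp: gov_budget_def budget_def Let_def)
  show "c \<in> gov_budget E h rt q q'"
    if "is_arg_max (util E h) (\<lambda>c. c \<in> budget E h q (\<lambda>i. inverse (1 + rt) * q' i)) c" for c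
    using that arg_max_budget_binds[OF that]
    by (simp add: gov_budget_def budget_def Let_def is_arg_max_def)
qed

lemma gov_demand0_eq_demand0:
  assumes "birth E h = 0" "q1 \<in> pos_vec (ncomm E 1)"
  shows "gov_demand0 E h q1 = demand0 E h 1 q1"
  unfolding gov_demand0_def demand0_def
proof (rule arg_max_on_subset_eq[OF demand0_single_valued])
  show "gov_budget0 E h q1 \<subseteq> budget0 E h 1 q1"
    by (auto simp: gov_budget0_def budget0_def dot_minus)
  show "c \<in> gov_budget0 E h q1"
    if "is_arg_max (util E h) (\<lambda>c. c \<in> budget0 E h 1 q1) c" for c
    using that arg_max_budget0_binds[OF that]
    by (simp add: gov_budget0_def budget0_def is_arg_max_def dot_minus)
qed (use assms in auto)

lemma alloc_rho:
  assumes r: "r \<in> nonneg_rates" and q: "q \<in> pos_prices E"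
  shows "alloc E 1 (rho r q) h = gov_alloc E r q h"
proof (cases "birth E h = 0")
  case True
  have "q 1 \<in> pos_vec (ncomm E 1)"
    using q by (simp add: pos_prices_def)
  then show ?thesis
    using gov_demand0_eq_demand0[OF True] rho_1[of r q]
    by (simp add: alloc_def gov_alloc_def True Let_def)
next
  case False
  define t where "t = birth E h"
  have t: "1 \<le> t"
    using False by (simp add: t_def)
  obtain k where k: "0 < k" "q t = (\<lambda>i. k * rho r q t i)"
    "(\<lambda>i. inverse (1 + r t) * q (t + 1) i) = (\<lambda>i. k * rho r q (t + 1) i)"
    using rho_scale[OF r, of q t] t by metis
  have "rho r q (t + 1) \<in> pos_vec (ncomm E (t + 1))"
    using rho_pos_prices[OF r q] by (simp add: pos_prices_def)
  then have "(\<lambda>i. inverse (1 + r t) * q (t + 1) i) \<in> pos_vec (ncomm E (t + 1))"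
    unfolding k(3) by (rule pos_vec_scale[OF k(1)])
  moreover have "q t \<in> pos_vec (ncomm E t)"
    using q t by (simp add: pos_prices_def)
  ultimately have "gov_demand E h (r t) (q t) (q (t + 1)) =
      demand E h (q t) (\<lambda>i. inverse (1 + r t) * q (t + 1) i)"
    using gov_demand_eq_demand t by (simp add: t_def)
  \<comment> \<open>Demand is homogeneous of degree 0, and both price vectors carry the same factor
    \<open>k\<close>.\<close>
  also have "\<dots> = demand E h (rho r q t) (rho r q (t + 1))"
    unfolding k(3) by (subst k(2)) (simp add: demand_def budget_scale[OF k(1)])
  finally show ?thesis
    using False by (simp add: alloc_def gov_alloc_def Let_def t_def)
qed

lemma equilibrium_rho:
  assumes "(r, q) \<in> HG E"
  shows "equilibrium E 1 (rho r q)"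
proof -
  have rq: "r \<in> nonneg_rates" "q \<in> pos_prices E" "markets_clear E (gov_alloc E r q)"
    using assms by (auto simp: HG_def)
  then show ?thesis
    using alloc_rho[OF rq(1,2)] rho_pos_prices[OF rq(1,2)]
    by (simp add: equilibrium_def markets_clear_def)
qed

section \<open>Money stock and nominal savings\<close>

lemma sum_gen_Un:
  assumes "1 \<le> t"
  shows "(\<Sum>h\<in>gen E (t - 1) \<union> gen E t. f h) = (\<Sum>h\<in>gen E (t - 1). f h) + (\<Sum>h\<in>gen E t. f h)"
  using assms by (intro sum.union_disjoint gen_finite) (auto simp: gen_def)

text \<open>Each clearing equation is weighted with \<open>p i\<close> and the results are added.
  The equality describes the handover of money: the old pay the young for what they buy beyond their
  endowments.\<close>

lemma market_value_clears:
  assumes "markets_clear E x" "1 \<le> t"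
  shows "(\<Sum>h\<in>gen E t. dot (ncomm E t) p (\<lambda>i. endow E h t i - x h t i)) =
    (\<Sum>h\<in>gen E (t - 1). dot (ncomm E t) p (\<lambda>i. x h t i - endow E h t i))"
proof -
  have "(\<Sum>h\<in>gen E t. endow E h t i - x h t i) = (\<Sum>h\<in>gen E (t - 1). x h t i - endow E h t i)"
    if "i \<in> {1..ncomm E t}" for i
    using assms that sum_gen_Un[OF assms(2), of "\<lambda>h. endow E h t i"]
    by (force simp: markets_clear_def sum_subtractf)
  then show ?thesis
    unfolding dot_sum[symmetric] by (simp add: dot_def)
qed

text \<open>The money stock travels from generation to generation. In period 1 the initial old spend
  all their money, 1 in total, so generation 1 saves 1. After that, binding budgets turn the savings
  of generation \<open>t\<close> into its net purchases in \<open>t + 1\<close>, which market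
  clearing equates with the savings of generation \<open>t + 1\<close>.\<close>

lemma nominal_savings_eq_1:
  assumes eq: "equilibrium E 1 p" and "1 \<le> t"
  shows "(\<Sum>h\<in>gen E t. dot (ncomm E t) (p t) (\<lambda>i. endow E h t i - alloc E 1 p h t i)) = 1"
  using \<open>1 \<le> t\<close>
proof (induction t rule: dec_induct)
  have pos: "p t \<in> pos_vec (ncomm E t)" if "1 \<le> t" for t
    using eq that by (simp add: equilibrium_def pos_prices_def)
  have mc: "markets_clear E (alloc E 1 p)"
    using eq by (simp add: equilibrium_def)
  {
    case base
    have "dot (ncomm E 1) (p 1) (\<lambda>i. alloc E 1 p h 1 i - endow E h 1 i) = money E h"
      if "h \<in> gen E 0" for h
      using that arg_max_budget0_binds[OF demand0_is_arg_max[of h 1 "p 1"]] pos[of 1]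
      by (simp add: alloc_def gen_def)
    then show ?case
      using market_value_clears[OF mc, of 1] money_sum by simp
  next
    case (step t)
    have "dot (ncomm E (t + 1)) (p (t + 1)) (\<lambda>i. alloc E 1 p h (t + 1) i - endow E h (t + 1) i) =
        dot (ncomm E t) (p t) (\<lambda>i. endow E h t i - alloc E 1 p h t i)" if "h \<in> gen E t" for h
    proof -
      have "birth E h = t"
        using that by (simp add: gen_def)
      then show ?thesis
        using arg_max_budget_binds[OF demand_is_arg_max[of h "p t" "p (t + 1)"]]
          pos[of t] pos[of "t + 1"] step.hyps
        by (simp add: alloc_def dot_minus)
    qed
    then show ?case
      using market_value_clears[OF mc, of "t + 1"] step.IH by simp
  }
qed

text \<open>Scale invariance allows real savings to be computed at the discounted prices. Nominal
  savings there are 1, so aggregate real savings are the reciprocal of the price level.\<close>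

lemma rel_savings_eq:
  assumes HG: "(r, q) \<in> HG E" and t: "1 \<le> t"
  shows "rel_savings E r q t = inverse (vnorm (ncomm E t) (rho r q t) * gen_endow E t t)"
proof -
  let ?p = "rho r q"
  obtain k where k: "0 < k" "q t = (\<lambda>i. k * ?p t i)"
    "(\<lambda>i. inverse (1 + r t) * q (t + 1) i) = (\<lambda>i. k * ?p (t + 1) i)"
    using rho_scale[of r q t] HG t by (metis (no_types, lifting) HG_def case_prodD mem_Collect_eq)
  have "(\<Sum>h\<in>gen E t. savings E h (q t) (\<lambda>i. inverse (1 + r t) * q (t + 1) i)) =
      (\<Sum>h\<in>gen E t. savings E h (?p t) (?p (t + 1)))"
    unfolding k(3) by (subst k(2)) (simp add: savings_scale[OF k(1)])
  also have "\<dots> = (\<Sum>h\<in>gen E t.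
      dot (ncomm E t) (?p t) (\<lambda>i. endow E h t i - alloc E 1 ?p h t i) / vnorm (ncomm E t) (?p t))"
    using t by (intro sum.cong) (auto simp: savings_eq alloc_def gen_def)
  also have "\<dots> = 1 / vnorm (ncomm E t) (?p t)"
    unfolding sum_divide_distrib[symmetric]
    by (simp only: nominal_savings_eq_1[OF equilibrium_rho[OF HG] t])
  finally show ?thesis
    by (simp add: rel_savings_def divide_inverse)
qed

end

section \<open>Divergence, stability and Pareto optimality\<close>

lemma suminf_ennreal_bounded_below_eq_top:
  fixes f :: "nat \<Rightarrow> real"
  assumes "0 < c" "\<And>n. c \<le> f n"
  shows "(\<Sum>n. ennreal (f n)) = \<infinity>"
proof -
  have "of_nat n * ennreal c \<le> (\<Sum>n. ennreal (f n))" for n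
  proof -
    have "of_nat n * ennreal c = (\<Sum>i<n. ennreal c)"
      by simp
    also have "\<dots> \<le> (\<Sum>i<n. ennreal (f i))"
      by (intro sum_mono ennreal_leI assms)
    also have "\<dots> \<le> (\<Sum>n. ennreal (f n))"
      by (intro sum_le_suminf) auto
    finally show ?thesis .
  qed
  \<comment> \<open>Evaluating the supremum is postponed, so that \<open>c\<close> can first move
    inside it and the bound can be used for each \<open>n\<close>.\<close>
  then have "(SUP n. of_nat n) * ennreal c \<le> (\<Sum>n. ennreal (f n))"
    by (simp add: SUP_mult_right_ennreal SUP_le_iff del: ennreal_SUP_of_nat_eq_top)
  then show ?thesis
    using assms(1) by (simp add: ennreal_SUP_of_nat_eq_top ennreal_top_mult top_unique)
qed

text \<open>In the fixed-point equation \<open>r t\<close> cancels. Two nonnegative terms with sum 0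
  remain, and their positive weights force both indicators to vanish.\<close>

lemma taylor3_stable:
  assumes "0 < \<theta>1" "0 < \<theta>2" and stable: "r = taylor3 E \<theta>1 \<theta>2 q0 pistar taustar r q"
  shows "inflation E q0 q t \<le> pistar"
    and "1 \<le> t \<Longrightarrow> taustar < rel_savings E r q t"
proof -
  have zero: "indicator {pistar<..} (inflation E q0 q (t - 1)) = (0::real) \<and>
      indicator {..taustar} (rel_savings E r q t) = (0::real)" if "1 \<le> t" for t
  proof -
    have "\<theta>1 * indicator {pistar<..} (inflation E q0 q (t - 1)) +
        \<theta>2 * indicator {..taustar} (rel_savings E r q t) = 0"
      using fun_cong[OF stable, of t] that by (simp add: taylor3_def)
    then show ?thesis
      using assms(1,2) by (auto simp: indicator_def of_bool_def split: if_splits)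
  qed
  \<comment> \<open>The rule looks back one period, so its component \<open>t + 1\<close> controls
    inflation at \<open>t\<close>; this includes \<open>t = 0\<close>, measured against
    \<open>q0\<close>.\<close>
  show "inflation E q0 q t \<le> pistar"
    using zero[of "t + 1"] by (simp add: indicator_def split: if_splits)
  show "taustar < rel_savings E r q t" if "1 \<le> t"
    using zero[OF that] by (simp add: indicator_def split: if_splits)
qed

theorem mainTheorem9:
  fixes E :: "'h economy"
    and \<theta>1 \<theta>2 q0 pistar taustar :: real
    and r :: "nat \<Rightarrow> real" and q :: cbundle
  assumes "standing_assumptions E"
    and "0 < \<theta>1" and "0 < \<theta>2"
    and "0 < q0" and "-1 < pistar" and "0 < taustar"
    and "(r, q) \<in> HG E"
    and "r = taylor3 E \<theta>1 \<theta>2 q0 pistar taustar r q"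
  shows "(\<forall>t. inflation E q0 q t \<le> pistar) \<and>
         (\<forall>t\<ge>1. rel_savings E r q t > taustar) \<and>
         rho r q \<in> H2PO E"
proof -
  interpret olg_economy E
    using assms(1) by (simp add: standing_assumptions_def)
  have crit: "pareto_criterion E"
    using assms(1) by (auto simp: standing_assumptions_def)
  note stable = taylor3_stable[OF assms(2,3,8)]
  have eq: "equilibrium E 1 (rho r q)"
    by (rule equilibrium_rho[OF assms(7)])
  have "(\<Sum>t. ennreal (inverse (vnorm (ncomm E (t + 1)) (rho r q (t + 1))
      * gen_endow E (t + 1) (t + 1)))) = \<infinity>"
  proof (rule suminf_ennreal_bounded_below_eq_top[OF assms(6)])
    \<comment> \<open>The series counts from 0 while periods start at 1, so the savings floor is
      applied in period \<open>t + 1\<close>.\<close>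
    show "taustar \<le> inverse (vnorm (ncomm E (t + 1)) (rho r q (t + 1))
        * gen_endow E (t + 1) (t + 1))" for t
      using stable(2)[of "t + 1"] rel_savings_eq[OF assms(7), of "t + 1"] by simp
  qed
  then have "pareto_optimal E 1 (rho r q)"
    using crit eq by (simp add: pareto_criterion_def)
  then show ?thesis
    using stable eq by (simp add: H2PO_def H2_def)
qed

end
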